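(* Let $\mathbf X=(X,\{X^i:i\in I\})$ be an s-manifold, and $\{U_a:a\in A\}$ an open cover of $X$. Then there exist smooth functions of s-manifolds $\eta_a:\mathbf X\to\mathbb R$ for $a\in A$ satisfying: (i) $\eta_a(X)\subseteq[0,1]\subset\mathbb R$ for all $a\in A$. (ii) $\operatorname{supp}\eta_a:=\overline{\{x\in X:\eta_a(x)\ne0\}}\subseteq U_a\subseteq X$ for all $a\in A$. (iii) Each $x\in X$ has an open neighbourhood $U$ such that there are only finitely many $a\in A$ with $\operatorname{supp}\eta_a\cap U\ne\emptyset$. (iv) $\sum_{a\in A}\eta_a\equiv1$, where the sum makes sense locally on $X$ by (iii).
   Context: **S-manifolds.** An s-manifold of dimension $n\ge 0$ is data $\mathbf X=(X,\{X^i:i\in I\})$ such that: (a) $X$ is a locally compact, Hausdorff, second countable topological space. (b) $I$ is finite or countable, and the $X^i$ (the strata) are nonempty, locally closed, pairwise disjoint subsets with $X=\coprod_{i\in I}X^i$ as sets. (c) Each $X^i$, with the subspace topology, is equipped with the structure of a smooth manifold (without boundary) of dimension $\dim X^i\le n$. (d) Each $x\in X$ has an open neighbourhood $U$ and a continuous map $f:U\to\mathbb R^N$ for some $N$ such that $f:U\to f(U)$ is a homeomorphism and $f|_{U\cap X^i}$ is a smooth embedding of manifolds for all $i\in I$. (e) Each $x\in X$ has an open neighbourhood $V$ such that $I_V=\{i\in I:V\cap X^i\ne\emptyset\}$ is finite, and there is a partial order $\preceq$ on $I_V$ such that: (i) for each $i\in I_V$ the closure of $V\cap X^i$ in $V$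 is contained in $\coprod_{j\in I_V:\,i\preceq j}(V\cap X^j)$; (ii) if $i\ne j$ in $I_V$ with $i\preceq j$, then either $\dim X^i\in\{n-1,n\}$ and $\dim X^j<\dim X^i$, or $\dim X^i\le n-2$ and $\dim X^j\le n-2$. **Smooth functions.** A smooth function (smooth map of s-manifolds) $f:\mathbf X\to\mathbb R$ is a continuous map $f:X\to\mathbb R$ such that $f|_{X^i}:X^i\to\mathbb R$ is a smooth map of manifolds for every stratum $X^i$. *)

theory Defs
  imports "HOL-Analysis.Analysis"
begin

section \<open>Smooth functions on open subsets of Euclidean space\<close>

text \<open>
  The dimension of a stratum varies with the stratum, so \<open>\<real>\<^sup>n\<close> is the space
  \<^const>\<open>Euclidean_space\<close> \<open>n\<close>: functions \<open>nat \<Rightarrow> real\<close> vanishing at all indices \<open>\<ge> n\<close>.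
\<close>

definition partial_deriv :: "nat \<Rightarrow> ((nat \<Rightarrow> real) \<Rightarrow> real) \<Rightarrow> (nat \<Rightarrow> real) \<Rightarrow> real" where
  "partial_deriv i f x = deriv (\<lambda>t. f (x(i := t))) (x i)"

text \<open>
  \<open>Ck_on n k V f\<close>: all iterated partial derivatives of \<open>f\<close> of order at most \<open>k\<close> exist and are
  continuous on \<open>V\<close>. It is meant for \<open>V\<close> open in \<open>\<real>\<^sup>n\<close>; then the values of \<open>f\<close> outside \<open>V\<close> are
  irrelevant.
\<close>

primrec Ck_on :: "nat \<Rightarrow> nat \<Rightarrow> (nat \<Rightarrow> real) set \<Rightarrow> ((nat \<Rightarrow> real) \<Rightarrow> real) \<Rightarrow> bool" where
  "Ck_on n 0 V f \<longleftrightarrow> continuous_map (subtopology (Euclidean_space n) V) euclideanreal f"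
| "Ck_on n (Suc k) V f \<longleftrightarrow>
     continuous_map (subtopology (Euclidean_space n) V) euclideanreal f \<and>
     (\<forall>i<n. (\<forall>x\<in>V. (\<lambda>t. f (x(i := t))) differentiable (at (x i))) \<and>
            Ck_on n k V (partial_deriv i f))"

definition Cinf_on :: "nat \<Rightarrow> (nat \<Rightarrow> real) set \<Rightarrow> ((nat \<Rightarrow> real) \<Rightarrow> real) \<Rightarrow> bool" where
  "Cinf_on n V f \<longleftrightarrow> (\<forall>k. Ck_on n k V f)"


section \<open>Smooth manifolds\<close>

text \<open>A chart is a pair of its domain and its coordinate map (arbitrary outside the domain).\<close>

type_synonym 'a chart = "'a set \<times> ('a \<Rightarrow> nat \<Rightarrow> real)"

definition chart_image :: "'a chart \<Rightarrow> (nat \<Rightarrow> real) set" where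
  "chart_image c = snd c ` fst c"

definition chart_inv :: "'a chart \<Rightarrow> (nat \<Rightarrow> real) \<Rightarrow> 'a" where
  "chart_inv c = inv_into (fst c) (snd c)"

definition is_chart :: "'a topology \<Rightarrow> nat \<Rightarrow> 'a chart \<Rightarrow> bool" where
  "is_chart M n c \<longleftrightarrow>
     openin M (fst c) \<and>
     openin (Euclidean_space n) (chart_image c) \<and>
     homeomorphic_map (subtopology M (fst c))
       (subtopology (Euclidean_space n) (chart_image c)) (snd c)"

definition smooth_transition :: "nat \<Rightarrow> 'a chart \<Rightarrow> 'a chart \<Rightarrow> bool" where
  "smooth_transition n c c' \<longleftrightarrow>
     (\<forall>j<n. Cinf_on n (snd c ` (fst c \<inter> fst c')) (\<lambda>y. snd c' (chart_inv c y) j))"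

definition compatible_charts :: "nat \<Rightarrow> 'a chart \<Rightarrow> 'a chart \<Rightarrow> bool" where
  "compatible_charts n c c' \<longleftrightarrow> smooth_transition n c c' \<and> smooth_transition n c' c"

definition smooth_atlas :: "'a topology \<Rightarrow> nat \<Rightarrow> 'a chart set \<Rightarrow> bool" where
  "smooth_atlas M n \<A> \<longleftrightarrow>
     (\<forall>c\<in>\<A>. is_chart M n c) \<and>
     (\<Union>c\<in>\<A>. fst c) = topspace M \<and>
     (\<forall>c\<in>\<A>. \<forall>c'\<in>\<A>. compatible_charts n c c')"

text \<open>A smooth structure is a maximal smooth atlas.\<close>

definition smooth_structure :: "'a topology \<Rightarrow> nat \<Rightarrow> 'a chart set \<Rightarrow> bool" where
  "smooth_structure M n \<A> \<longleftrightarrow>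
     smooth_atlas M n \<A> \<and>
     (\<forall>c. is_chart M n c \<and> (\<forall>c'\<in>\<A>. compatible_charts n c c') \<longrightarrow> c \<in> \<A>)"

definition smooth_manifold :: "'a topology \<Rightarrow> nat \<Rightarrow> 'a chart set \<Rightarrow> bool" where
  "smooth_manifold M n \<A> \<longleftrightarrow>
     Hausdorff_space M \<and> second_countable M \<and> smooth_structure M n \<A>"

text \<open>The smooth structure induced on an open subset \<open>W\<close>, for a maximal atlas \<open>\<A>\<close>.\<close>

definition restrict_charts :: "'a chart set \<Rightarrow> 'a set \<Rightarrow> 'a chart set" where
  "restrict_charts \<A> W = {c\<in>\<A>. fst c \<subseteq> W}"

definition smooth_real_function :: "nat \<Rightarrow> 'a chart set \<Rightarrow> ('a \<Rightarrow> real) \<Rightarrow> bool" where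
  "smooth_real_function n \<A> f \<longleftrightarrow>
     (\<forall>c\<in>\<A>. Cinf_on n (chart_image c) (\<lambda>y. f (chart_inv c y)))"

text \<open>The condition states that the \<open>n\<close> columns of the Jacobian matrix are linearly independent.\<close>

definition immersive_at :: "nat \<Rightarrow> nat \<Rightarrow> 'a chart \<Rightarrow> ('a \<Rightarrow> nat \<Rightarrow> real) \<Rightarrow> 'a \<Rightarrow> bool" where
  "immersive_at n N c f p \<longleftrightarrow>
     (\<forall>v :: nat \<Rightarrow> real.
        (\<forall>j<N. (\<Sum>i<n. v i * partial_deriv i (\<lambda>y. f (chart_inv c y) j) (snd c p)) = 0) \<longrightarrow>
        (\<forall>i<n. v i = 0))"

text \<open>A smooth embedding of a manifold into \<open>\<real>\<^sup>N\<close>: a smooth immersion that is a homeomorphism onto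
  its image.\<close>

definition smooth_embedding ::
  "'a topology \<Rightarrow> nat \<Rightarrow> 'a chart set \<Rightarrow> nat \<Rightarrow> ('a \<Rightarrow> nat \<Rightarrow> real) \<Rightarrow> bool" where
  "smooth_embedding M n \<A> N f \<longleftrightarrow>
     embedding_map M (Euclidean_space N) f \<and>
     (\<forall>j<N. smooth_real_function n \<A> (\<lambda>x. f x j)) \<and>
     (\<forall>c\<in>\<A>. \<forall>p\<in>fst c. immersive_at n N c f p)"


section \<open>S-manifolds\<close>

definition locally_closed_in :: "'a topology \<Rightarrow> 'a set \<Rightarrow> bool" where
  "locally_closed_in X T \<longleftrightarrow> (\<exists>U C. openin X U \<and> closedin X C \<and> T = U \<inter> C)"

definition strata_meeting :: "'i set \<Rightarrow> ('i \<Rightarrow> 'a set) \<Rightarrow> 'a set \<Rightarrow> 'i set" where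
  "strata_meeting I S V = {i\<in>I. V \<inter> S i \<noteq> {}}"

text \<open>
  An s-manifold of dimension \<open>n\<close> with underlying space \<open>X\<close> and strata \<open>S i\<close>, \<open>i \<in> I\<close>, the stratum
  \<open>S i\<close> being a smooth manifold of dimension \<open>d i\<close> with maximal atlas \<open>\<A> i\<close>. In
  \<open>frontier\<close>, \<open>(i, j) \<in> r\<close> stands for \<open>i \<preceq> j\<close>, and the conditions on dimensions are written without
  the truncated subtractions \<open>n - 1\<close> and \<open>n - 2\<close>.
\<close>

locale s_manifold =
  fixes n :: nat
    and X :: "'a topology"
    and I :: "'i set"
    and S :: "'i \<Rightarrow> 'a set"
    and d :: "'i \<Rightarrow> nat"
    and \<A> :: "'i \<Rightarrow> 'a chart set"
  assumes locally_compact: "locally_compact_space X"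
    and Hausdorff: "Hausdorff_space X"
    and second_countable: "second_countable X"
    and countable_index: "countable I"
    and strata_nonempty: "\<And>i. i \<in> I \<Longrightarrow> S i \<noteq> {}"
    and strata_locally_closed: "\<And>i. i \<in> I \<Longrightarrow> locally_closed_in X (S i)"
    and strata_disjoint: "disjoint_family_on S I"
    and strata_cover: "(\<Union>i\<in>I. S i) = topspace X"
    and strata_manifold: "\<And>i. i \<in> I \<Longrightarrow> smooth_manifold (subtopology X (S i)) (d i) (\<A> i)"
    and strata_dim: "\<And>i. i \<in> I \<Longrightarrow> d i \<le> n"
    and local_embedding: "\<And>x. x \<in> topspace X \<Longrightarrow>
      \<exists>U N f. openin X U \<and> x \<in> U \<and>
        embedding_map (subtopology X U) (Euclidean_space N) f \<and>
        (\<forall>i\<in>I. smooth_embedding (subtopology X (U \<inter> S i)) (d i)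
                  (restrict_charts (\<A> i) (U \<inter> S i)) N f)"
    and frontier: "\<And>x. x \<in> topspace X \<Longrightarrow>
      \<exists>V. openin X V \<and> x \<in> V \<and> finite (strata_meeting I S V) \<and>
        (\<exists>r. partial_order_on (strata_meeting I S V) r \<and>
          (\<forall>i\<in>strata_meeting I S V.
             subtopology X V closure_of (V \<inter> S i)
               \<subseteq> (\<Union>j\<in>{j\<in>strata_meeting I S V. (i, j) \<in> r}. V \<inter> S j)) \<and>
          (\<forall>i\<in>strata_meeting I S V. \<forall>j\<in>strata_meeting I S V. i \<noteq> j \<and> (i, j) \<in> r \<longrightarrow>
             (d i + 1 = n \<or> d i = n) \<and> d j < d i \<or>
             d i + 2 \<le> n \<and> d j + 2 \<le> n))"

definition s_smooth_function ::
  "'a topology \<Rightarrow> 'i set \<Rightarrow> ('i \<Rightarrow> nat) \<Rightarrow> ('i \<Rightarrow> 'a chart set) \<Rightarrow> ('a \<Rightarrow> real) \<Rightarrow> bool" where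
  "s_smooth_function X I d \<A> f \<longleftrightarrow>
     continuous_map X euclideanreal f \<and>
     (\<forall>i\<in>I. smooth_real_function (d i) (\<A> i) f)"

definition supp_in :: "'a topology \<Rightarrow> ('a \<Rightarrow> real) \<Rightarrow> 'a set" where
  "supp_in X f = X closure_of {x\<in>topspace X. f x \<noteq> 0}"

end

theory Submission
  imports Defs
begin

text \<open>
  Composing the local embeddings into \<open>\<real>\<^sup>N\<close> with a smooth step function of the squared distance gives
  bump functions that are smooth on every stratum at once. By second countability, countably many
  bumps \<open>b k\<close>, each supported in one set of the cover, suffice for the open sets \<open>W k\<close> on which
  \<open>b k = 1\<close> to cover the space. The functions \<open>h k = b k * (\<Prod>j<k. 1 - b j)\<close> vanish on \<open>W m\<close> for
  all \<open>m < k\<close>, so they are locally finite without any refinement of the cover, and they telescope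
  to \<open>1\<close> without any normalising division. Grouping the \<open>h k\<close> by the set of the cover that contains
  the support of \<open>b k\<close> gives the partition of unity.
\<close>

text \<open>Pasting lemma for a single map: the index family consists of all open sets on which the
  restriction is continuous, so agreement on overlaps is automatic.\<close>

lemma continuous_map_locallyI:
  assumes "\<And>x. x \<in> topspace X \<Longrightarrow>
    \<exists>W. openin X W \<and> x \<in> W \<and> continuous_map (subtopology X W) Y f"
  shows "continuous_map X Y f"
proof -
  define I where "I = {W. openin X W \<and> continuous_map (subtopology X W) Y f}"
  show ?thesis
    by (rule pasting_lemma[of I X "\<lambda>W. W" Y "\<lambda>_. f" f]) (use assms in \<open>auto simp: I_def\<close>)
qed

subsection \<open>Calculus of \<open>C\<^sup>k\<close> functions on open sets\<close>

text \<open>A coordinate line is continuous into \<open>Euclidean_space n\<close>: as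
  \<open>i < n\<close>, the zeros at indices \<open>\<ge> n\<close> are untouched. This is what
  makes partial derivatives local on open sets.\<close>

lemma eventually_fun_upd_mem:
  assumes V: "openin (Euclidean_space n) V" and "x \<in> V" and "i < n"
  shows "eventually (\<lambda>t. x(i := t) \<in> V) (nhds (x i))"
proof -
  have x: "x \<in> topspace (Euclidean_space n)"
    using assms openin_subset by blast
  have "continuous_map euclideanreal (Euclidean_space n) (\<lambda>t. x(i := t))"
    unfolding Euclidean_space_def continuous_map_in_subtopology continuous_map_componentwise_UNIV
    using x \<open>i < n\<close> by (auto simp: topspace_Euclidean_space fun_upd_def)
  then have "openin euclideanreal {t \<in> topspace euclideanreal. x(i := t) \<in> V}"
    using V by (rule openin_continuous_map_preimage)
  then have "open {t. x(i := t) \<in> V}" by simp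
  then show ?thesis
    using \<open>x \<in> V\<close> eventually_nhds_in_open[of "{t. x(i := t) \<in> V}" "x i"] by simp
qed

text \<open>A partial derivative at \<open>x\<close> looks along a coordinate line, which stays in
  the open set \<open>V\<close> near \<open>x\<close>; hence derivatives of \<open>f\<close> and
  \<open>g\<close> agree on \<open>V\<close> and the induction passes to them.\<close>

lemma Ck_on_cong:
  assumes "openin (Euclidean_space n) V" "\<And>x. x \<in> V \<Longrightarrow> f x = g x" "Ck_on n k V f"
  shows "Ck_on n k V g"
  using assms(2,3)
proof (induction k arbitrary: f g)
  case 0
  then show ?case
    by (auto elim!: continuous_map_eq)
next
  case (Suc k)
  have "continuous_map (subtopology (Euclidean_space n) V) euclideanreal g"
    using Suc.prems by (auto elim!: continuous_map_eq)
  moreover have "(\<lambda>t. g (x(i := t))) differentiable (at (x i)) \<and> partial_deriv i f x = partial_deriv i g x"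
    if "i < n" "x \<in> V" for i x
  proof -
    have ev: "eventually (\<lambda>t. f (x(i := t)) = g (x(i := t))) (nhds (x i))"
      using eventually_fun_upd_mem[OF assms(1) that(2,1)] by eventually_elim (use Suc.prems in auto)
    have "(\<lambda>t. f (x(i := t))) differentiable (at (x i))"
      using Suc.prems that by simp
    then show ?thesis
      unfolding real_differentiable_def partial_deriv_def
      using DERIV_cong_ev[OF refl ev refl] deriv_cong_ev[OF ev refl] by auto
  qed
  moreover from this have "Ck_on n k V (partial_deriv i g)" if "i < n" for i
    using Suc.IH[of "partial_deriv i f" "partial_deriv i g"] Suc.prems(2) that by auto
  ultimately show ?case
    by simp
qed

text \<open>Any family of derivatives may stand in for \<open>partial_deriv\<close>, so that the
  sum, product and chain rules apply directly.\<close>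

lemma Ck_on_Suc_iff:
  assumes "openin (Euclidean_space n) V"
  shows "Ck_on n (Suc k) V f \<longleftrightarrow>
    continuous_map (subtopology (Euclidean_space n) V) euclideanreal f \<and>
    (\<exists>g. \<forall>i<n. (\<forall>x\<in>V. ((\<lambda>t. f (x(i := t))) has_real_derivative g i x) (at (x i))) \<and>
               Ck_on n k V (g i))" (is "?L \<longleftrightarrow> ?R")
proof
  assume ?L
  then show ?R
    by (auto simp: partial_deriv_def DERIV_deriv_iff_real_differentiable
        intro!: exI[of _ "\<lambda>i. partial_deriv i f"])
next
  assume R: ?R
  then obtain g where g: "\<And>i x. \<lbrakk>i < n; x \<in> V\<rbrakk> \<Longrightarrow>
      ((\<lambda>t. f (x(i := t))) has_real_derivative g i x) (at (x i))"
    "\<And>i. i < n \<Longrightarrow> Ck_on n k V (g i)"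
    by blast
  \<comment> \<open>\<open>g i\<close> and the literal partial derivative are only known to agree on
    \<open>V\<close>, hence the transfer by congruence.\<close>
  have "Ck_on n k V (partial_deriv i f)" if "i < n" for i
    using assms _ g(2)[OF that]
  proof (rule Ck_on_cong)
    show "g i x = partial_deriv i f x" if "x \<in> V" for x
      using DERIV_imp_deriv[OF g(1)[OF \<open>i < n\<close> that]] by (simp add: partial_deriv_def)
  qed
  then show ?L
    using R g(1) by (auto simp: real_differentiable_def)
qed

lemma Ck_on_SucI:
  assumes "openin (Euclidean_space n) V"
    and "continuous_map (subtopology (Euclidean_space n) V) euclideanreal f"
    and "\<And>i x. \<lbrakk>i < n; x \<in> V\<rbrakk> \<Longrightarrow> ((\<lambda>t. f (x(i := t))) has_real_derivative g i x) (at (x i))"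
    and "\<And>i. i < n \<Longrightarrow> Ck_on n k V (g i)"
  shows "Ck_on n (Suc k) V f"
  using assms unfolding Ck_on_Suc_iff[OF assms(1)] by blast

lemma Ck_on_imp_continuous_map:
  "Ck_on n k V f \<Longrightarrow> continuous_map (subtopology (Euclidean_space n) V) euclideanreal f"
  by (cases k) auto

lemma Ck_on_Suc_imp_Ck_on: "Ck_on n (Suc k) V f \<Longrightarrow> Ck_on n k V f"
proof (induction k arbitrary: f)
  case (Suc k)
  then show ?case by (metis Ck_on.simps(2))
qed simp

lemma Ck_on_subset: "Ck_on n k V f \<Longrightarrow> W \<subseteq> V \<Longrightarrow> Ck_on n k W f"
  by (induction k arbitrary: f) (auto intro: continuous_map_from_subtopology_mono)

text \<open>Differentiability is already a pointwise condition, so only continuity has to be pasted,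
  at every order of differentiation.\<close>

lemma Ck_on_locallyI:
  assumes "\<And>x. x \<in> V \<Longrightarrow> \<exists>W. openin (Euclidean_space n) W \<and> x \<in> W \<and> Ck_on n k W f"
  shows "Ck_on n k V f"
  using assms
proof (induction k arbitrary: f)
  have cont: "continuous_map (subtopology (Euclidean_space n) V) euclideanreal f"
    if loc: "\<And>x. x \<in> V \<Longrightarrow> \<exists>W. openin (Euclidean_space n) W \<and> x \<in> W \<and> Ck_on n k W f" for f k
  proof (rule continuous_map_locallyI)
    fix x assume "x \<in> topspace (subtopology (Euclidean_space n) V)"
    then obtain W where W: "openin (Euclidean_space n) W" "x \<in> W" "Ck_on n k W f" "x \<in> V"
      using loc by auto
    then have "continuous_map (subtopology (subtopology (Euclidean_space n) V) (V \<inter> W)) euclideanreal f"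
      unfolding subtopology_subtopology
      by (intro continuous_map_from_subtopology_mono[OF Ck_on_imp_continuous_map]) auto
    then show "\<exists>W. openin (subtopology (Euclidean_space n) V) W \<and> x \<in> W \<and>
        continuous_map (subtopology (subtopology (Euclidean_space n) V) W) euclideanreal f"
      using W openin_subtopology_Int2 by blast
  qed
  {
    case 0
    then show ?case using cont[of 0 f] by simp
  next
    case (Suc k)
    have "(\<lambda>t. f (x(i := t))) differentiable (at (x i))" if "x \<in> V" "i < n" for x i
      using Suc.prems[OF that(1)] that(2) by auto
    moreover have "Ck_on n k V (partial_deriv i f)" if "i < n" for i
      using Suc.prems that by (intro Suc.IH) (metis Ck_on.simps(2))
    ultimately show ?case
      using cont[OF Suc.prems] by simp
  }
qed

lemma Ck_on_const: "Ck_on n k V (\<lambda>_. c)"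
  by (induction k arbitrary: c) (simp_all add: partial_deriv_def[abs_def])

lemma Ck_on_add:
  assumes "openin (Euclidean_space n) V" "Ck_on n k V f" "Ck_on n k V g"
  shows "Ck_on n k V (\<lambda>x. f x + g x)"
  using assms(2,3)
proof (induction k arbitrary: f g)
  case 0
  then show ?case by (auto intro: continuous_map_add)
next
  case (Suc k)
  obtain f' g' where
    "\<And>i x. i < n \<Longrightarrow> x \<in> V \<Longrightarrow> ((\<lambda>t. f (x(i := t))) has_real_derivative f' i x) (at (x i))"
    "\<And>i x. i < n \<Longrightarrow> x \<in> V \<Longrightarrow> ((\<lambda>t. g (x(i := t))) has_real_derivative g' i x) (at (x i))"
    "\<And>i. i < n \<Longrightarrow> Ck_on n k V (f' i)" "\<And>i. i < n \<Longrightarrow> Ck_on n k V (g' i)"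
    using Suc.prems unfolding Ck_on_Suc_iff[OF assms(1)] by blast
  then show ?case
    using Suc.prems[THEN Ck_on_imp_continuous_map]
    by (intro Ck_on_SucI[OF assms(1), where g = "\<lambda>i x. f' i x + g' i x"]
        continuous_map_add Suc.IH DERIV_add)
qed

lemma Ck_on_mult:
  assumes "openin (Euclidean_space n) V" "Ck_on n k V f" "Ck_on n k V g"
  shows "Ck_on n k V (\<lambda>x. f x * g x)"
  using assms(2,3)
proof (induction k arbitrary: f g)
  case 0
  then show ?case by (auto intro: continuous_map_real_mult)
next
  case (Suc k)
  obtain f' g' where
    D: "\<And>i x. i < n \<Longrightarrow> x \<in> V \<Longrightarrow> ((\<lambda>t. f (x(i := t))) has_real_derivative f' i x) (at (x i))"
    "\<And>i x. i < n \<Longrightarrow> x \<in> V \<Longrightarrow> ((\<lambda>t. g (x(i := t))) has_real_derivative g' i x) (at (x i))"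
    "\<And>i. i < n \<Longrightarrow> Ck_on n k V (f' i)" "\<And>i. i < n \<Longrightarrow> Ck_on n k V (g' i)"
    using Suc.prems unfolding Ck_on_Suc_iff[OF assms(1)] by blast
  have "((\<lambda>t. f (x(i := t)) * g (x(i := t))) has_real_derivative f' i x * g x + g' i x * f x) (at (x i))"
    if "i < n" "x \<in> V" for i x
    using DERIV_mult[OF D(1,2)[OF that]] by simp
  \<comment> \<open>The product rule mixes first derivatives with \<open>f\<close> and
    \<open>g\<close> themselves, which are therefore lowered to order \<open>k\<close> before the
    induction hypothesis is used.\<close>
  moreover have "Ck_on n k V (\<lambda>x. f' i x * g x + g' i x * f x)" if "i < n" for i
    using Suc.prems[THEN Ck_on_Suc_imp_Ck_on] D(3,4) that
    by (intro Ck_on_add[OF assms(1)] Suc.IH) auto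
  ultimately show ?case
    using Suc.prems[THEN Ck_on_imp_continuous_map]
    by (intro Ck_on_SucI[OF assms(1), where g = "\<lambda>i x. f' i x * g x + g' i x * f x"]
        continuous_map_real_mult)
qed

text \<open>The sequence \<open>D\<close> lists all iterated derivatives; shifting it shows that the
  derivative of a smooth function is again smooth.\<close>

definition smooth_on_reals :: "(real \<Rightarrow> real) \<Rightarrow> bool" where
  "smooth_on_reals h \<longleftrightarrow>
     (\<exists>D. D 0 = h \<and> (\<forall>k x. (D k has_real_derivative D (Suc k) x) (at x)))"

lemma smooth_on_realsE:
  assumes "smooth_on_reals h"
  obtains h' where "smooth_on_reals h'" "\<And>x. (h has_real_derivative h' x) (at x)"
proof -
  obtain D where D: "D 0 = h" "\<And>k x. (D k has_real_derivative D (Suc k) x) (at x)"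
    using assms by (auto simp: smooth_on_reals_def)
  have "smooth_on_reals (D 1)"
    unfolding smooth_on_reals_def using D(2) by (intro exI[of _ "\<lambda>k. D (Suc k)"]) auto
  then show ?thesis
    by (rule that) (use D(1) D(2)[of 0] in simp)
qed

text \<open>By the chain rule a partial derivative is a product with factor \<open>h' (f x)\<close>,
  so the induction must leave \<open>h\<close> arbitrary.\<close>

lemma Ck_on_compose:
  assumes "openin (Euclidean_space n) V" "smooth_on_reals h" "Ck_on n k V f"
  shows "Ck_on n k V (\<lambda>x. h (f x))"
  using assms(2,3)
proof (induction k arbitrary: h)
  have cont: "continuous_map (subtopology (Euclidean_space n) V) euclideanreal (\<lambda>x. h (f x))"
    if h: "smooth_on_reals h" and f: "Ck_on n k V f" for h k
  proof -
    obtain h' where "\<And>x. (h has_real_derivative h' x) (at x)"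
      using smooth_on_realsE[OF h] by blast
    then have "continuous_map euclideanreal euclideanreal h"
      using DERIV_continuous_on[of UNIV h h'] by simp
    then show ?thesis
      by (rule continuous_map_compose[OF Ck_on_imp_continuous_map[OF f], unfolded o_def])
  qed
  {
    case 0
    then show ?case using cont[of h 0] by simp
  next
    case (Suc k)
    obtain h' where h': "smooth_on_reals h'" "\<And>x. (h has_real_derivative h' x) (at x)"
      using smooth_on_realsE[OF Suc.prems(1)] by blast
    obtain f' where
      f': "\<And>i x. i < n \<Longrightarrow> x \<in> V \<Longrightarrow> ((\<lambda>t. f (x(i := t))) has_real_derivative f' i x) (at (x i))"
      "\<And>i. i < n \<Longrightarrow> Ck_on n k V (f' i)"
      using Suc.prems unfolding Ck_on_Suc_iff[OF assms(1)] by blast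
    have "((\<lambda>t. h (f (x(i := t)))) has_real_derivative h' (f x) * f' i x) (at (x i))"
      if "i < n" "x \<in> V" for i x
      using DERIV_chain2[of h _ "\<lambda>t. f (x(i := t))" "x i", OF _ f'(1)[OF that]] h'(2)[of "f x"]
      by simp
    moreover have "Ck_on n k V (\<lambda>x. h' (f x) * f' i x)" if "i < n" for i
      using Suc.IH[OF h'(1)] Suc.prems(2)[THEN Ck_on_Suc_imp_Ck_on] f'(2) that
      by (intro Ck_on_mult[OF assms(1)]) auto
    ultimately show ?case
      using cont[OF Suc.prems]
      by (intro Ck_on_SucI[OF assms(1), where g = "\<lambda>i x. h' (f x) * f' i x"])
  }
qed

section \<open>Passage from finite to infinite order of differentiability\<close>

lemma Cinf_on_subset: "Cinf_on n V f \<Longrightarrow> W \<subseteq> V \<Longrightarrow> Cinf_on n W f"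
  by (auto simp: Cinf_on_def intro: Ck_on_subset)

lemma Cinf_on_cong:
  "\<lbrakk>openin (Euclidean_space n) V; \<And>x. x \<in> V \<Longrightarrow> f x = g x; Cinf_on n V f\<rbrakk> \<Longrightarrow> Cinf_on n V g"
  using Ck_on_cong[of n V f g] by (simp add: Cinf_on_def)

lemma Cinf_on_locallyI:
  assumes "\<And>x. x \<in> V \<Longrightarrow> \<exists>W. openin (Euclidean_space n) W \<and> x \<in> W \<and> Cinf_on n W f"
  shows "Cinf_on n V f"
  unfolding Cinf_on_def
proof
  show "Ck_on n k V f" for k
    by (rule Ck_on_locallyI) (use assms in \<open>auto simp: Cinf_on_def\<close>)
qed

lemma Cinf_on_const: "Cinf_on n V (\<lambda>_. c)"
  by (simp add: Cinf_on_def Ck_on_const)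

lemma Cinf_on_add:
  "\<lbrakk>openin (Euclidean_space n) V; Cinf_on n V f; Cinf_on n V g\<rbrakk> \<Longrightarrow> Cinf_on n V (\<lambda>x. f x + g x)"
  by (simp add: Cinf_on_def Ck_on_add)

lemma Cinf_on_mult:
  "\<lbrakk>openin (Euclidean_space n) V; Cinf_on n V f; Cinf_on n V g\<rbrakk> \<Longrightarrow> Cinf_on n V (\<lambda>x. f x * g x)"
  by (simp add: Cinf_on_def Ck_on_mult)

lemma Cinf_on_compose:
  "\<lbrakk>openin (Euclidean_space n) V; smooth_on_reals h; Cinf_on n V f\<rbrakk> \<Longrightarrow> Cinf_on n V (\<lambda>x. h (f x))"
  by (simp add: Cinf_on_def Ck_on_compose)

lemma Cinf_on_sum:
  assumes "openin (Euclidean_space n) V" "\<And>j. j \<in> J \<Longrightarrow> Cinf_on n V (f j)"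
  shows "Cinf_on n V (\<lambda>x. \<Sum>j\<in>J. f j x)"
  using assms(2)
proof (induction J rule: infinite_finite_induct)
  case (insert j J)
  then show ?case
    using Cinf_on_add[OF assms(1), of "f j" "\<lambda>x. \<Sum>j\<in>J. f j x"] by simp
qed (simp_all add: Cinf_on_const)

subsection \<open>A smooth step function\<close>

text \<open>The case \<open>p = 1\<close> is the classical flat function; the polynomial parameter
  makes the family closed under differentiation.\<close>

definition exp_flat :: "real poly \<Rightarrow> real \<Rightarrow> real" where
  "exp_flat p t = (if t > 0 then poly p (1 / t) * exp (- (1 / t)) else 0)"

lemma poly_exp_tendsto_0: "((\<lambda>u. poly p u * exp (- u)) \<longlongrightarrow> (0::real)) at_top"
proof -
  have "((\<lambda>u. \<Sum>i\<le>degree p. coeff p i * (u ^ i / exp u)) \<longlongrightarrow> (\<Sum>i\<le>degree p. coeff p i * 0)) at_top"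
    by (intro tendsto_intros tendsto_power_div_exp_0)
  then show ?thesis
    by (simp add: poly_altdef sum_distrib_right exp_minus divide_inverse mult.assoc)
qed

text \<open>With \<open>u = 1 / t\<close> one has \<open>du/dt = - u^2\<close>, so
  \<open>p(u) exp(-u)\<close> has derivative \<open>u^2 (p(u) - p'(u)) exp(-u)\<close>. At
  \<open>0\<close> the one-sided difference quotients both tend to \<open>0\<close>.\<close>

lemma DERIV_exp_flat:
  "(exp_flat p has_real_derivative exp_flat ([:0, 0, 1:] * (p - pderiv p)) t) (at t)"
proof (cases t "0::real" rule: linorder_cases)
  case less
  have "eventually (\<lambda>s. s < 0) (nhds t)"
    using less eventually_nhds_in_open[of "{..<0}" t] by simp
  then have "eventually (\<lambda>s. 0 = exp_flat p s) (nhds t)"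
    by eventually_elim (simp add: exp_flat_def)
  from DERIV_cong_ev[OF refl this refl, of 0] have "(exp_flat p has_real_derivative 0) (at t)"
    by simp
  then show ?thesis
    using less by (simp add: exp_flat_def)
next
  case greater
  have "((\<lambda>t. poly p (1 / t) * exp (- (1 / t))) has_real_derivative
      poly ([:0, 0, 1:] * (p - pderiv p)) (1 / t) * exp (- (1 / t))) (at t)"
  proof -
    have u: "((\<lambda>t. 1 / t) has_real_derivative - ((1 / t) * (1 / t))) (at t)"
      using greater by (auto intro!: derivative_eq_intros)
    have "((\<lambda>t. poly p (1 / t)) has_real_derivative poly (pderiv p) (1 / t) * - ((1 / t) * (1 / t))) (at t)"
      by (rule DERIV_chain2[OF poly_DERIV u])
    moreover have "((\<lambda>t. exp (- (1 / t))) has_real_derivative exp (- (1 / t)) * - (- ((1 / t) * (1 / t)))) (at t)"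
      by (rule DERIV_fun_exp[OF DERIV_minus[OF u]])
    ultimately show ?thesis
      by (rule DERIV_mult[THEN DERIV_cong]) (simp add: algebra_simps)
  qed
  moreover have "eventually (\<lambda>s. s > 0) (nhds t)"
    using greater eventually_nhds_in_open[of "{0<..}" t] by simp
  then have "eventually (\<lambda>s. poly p (1 / s) * exp (- (1 / s)) = exp_flat p s) (nhds t)"
    by eventually_elim (simp add: exp_flat_def)
  ultimately show ?thesis
    using DERIV_cong_ev[OF refl, of "\<lambda>s. poly p (1 / s) * exp (- (1 / s))" "exp_flat p" t] greater
    by (simp add: exp_flat_def)
next
  case equal
  have "((\<lambda>h. exp_flat p h / h) \<longlongrightarrow> 0) (at_left 0)"
    by (rule tendsto_eventually)
      (auto simp: exp_flat_def eventually_at_left_field intro!: exI[of _ "-1"])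
  moreover have "((\<lambda>h. exp_flat p h / h) \<longlongrightarrow> 0) (at_right 0)"
  proof -
    \<comment> \<open>Dividing by \<open>h\<close> multiplies the polynomial in \<open>1 / h\<close>
      by its variable, and exponential decay beats this polynomial too.\<close>
    have "((\<lambda>h. poly ([:0, 1:] * p) (inverse h) * exp (- inverse h)) \<longlongrightarrow> 0) (at_right 0)"
      by (rule filterlim_compose[OF poly_exp_tendsto_0 filterlim_inverse_at_top_right])
    moreover have "eventually (\<lambda>h. poly ([:0, 1:] * p) (inverse h) * exp (- inverse h) = exp_flat p h / h)
        (at_right (0::real))"
      using eventually_at_right_less[of 0]
      by eventually_elim (simp add: exp_flat_def divide_inverse)
    ultimately show ?thesis
      by (rule Lim_transform_eventually)
  qed
  ultimately have "((\<lambda>h. exp_flat p h / h) \<longlongrightarrow> 0) (at 0)"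
    by (rule filterlim_split_at)
  then show ?thesis
    using equal by (simp add: DERIV_def exp_flat_def)
qed

lemma smooth_on_reals_exp_flat: "smooth_on_reals (exp_flat p)"
proof -
  let ?q = "\<lambda>p. [:0, 0, 1:] * (p - pderiv p)"
  have "(exp_flat ((?q ^^ k) p) has_real_derivative exp_flat ((?q ^^ Suc k) p) t) (at t)" for k t
    using DERIV_exp_flat by simp
  then show ?thesis
    unfolding smooth_on_reals_def by (intro exI[of _ "\<lambda>k. exp_flat ((?q ^^ k) p)"]) simp
qed

text \<open>
  With the flat function \<open>e t = exp (- 1 / t)\<close>, extended by \<open>0\<close>, this is \<open>1 - e (1 - e s / e r) / e 1\<close>:
  composing \<open>e\<close> with itself yields a step function without dividing by a function.
\<close>

definition smooth_step :: "real \<Rightarrow> real \<Rightarrow> real" where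
  "smooth_step r s = 1 - exp 1 * exp_flat 1 (1 - exp_flat 1 s / exp_flat 1 r)"

lemma exp_flat_1_mono: "s \<le> t \<Longrightarrow> exp_flat 1 s \<le> exp_flat 1 t"
  by (auto simp: exp_flat_def frac_le)

lemma exp_flat_1_pos: "t > 0 \<Longrightarrow> exp_flat 1 t > 0"
  by (simp add: exp_flat_def)

lemma exp_flat_1_nonneg: "exp_flat 1 t \<ge> 0"
  by (simp add: exp_flat_def)

text \<open>The inner flat function vanishes, the outer one is taken at \<open>1\<close>, and
  \<open>exp 1 * exp (- 1) = 1\<close>.\<close>

lemma smooth_step_eq_0: "s \<le> 0 \<Longrightarrow> smooth_step r s = 0"
  by (simp add: smooth_step_def exp_flat_def flip: exp_add)

text \<open>The quotient is at least \<open>1\<close>, so the outer flat function is taken at a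
  nonpositive argument and vanishes.\<close>

lemma smooth_step_eq_1:
  assumes "r > 0" "s \<ge> r"
  shows "smooth_step r s = 1"
proof -
  have "exp_flat 1 s / exp_flat 1 r \<ge> 1"
    using assms exp_flat_1_mono[of r s] exp_flat_1_pos[of r] by simp
  then show ?thesis
    by (simp add: smooth_step_def exp_flat_def[of 1 "1 - _"])
qed

lemma smooth_step_bounds: "smooth_step r s \<in> {0..1}"
proof -
  have "exp_flat 1 (1 - exp_flat 1 s / exp_flat 1 r) \<le> exp_flat 1 1"
    by (intro exp_flat_1_mono) (simp add: exp_flat_1_nonneg)
  also have "exp_flat 1 1 = exp (- 1)"
    by (simp add: exp_flat_def)
  finally have "exp 1 * exp_flat 1 (1 - exp_flat 1 s / exp_flat 1 r) \<le> exp 1 * exp (- 1)"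
    by simp
  then show ?thesis
    by (simp add: smooth_step_def exp_flat_1_nonneg flip: exp_add)
qed

lemma continuous_on_exp_flat: "continuous_on S (exp_flat p)"
  using DERIV_continuous_on[OF DERIV_exp_flat[THEN has_field_derivative_at_within]] .

lemma continuous_map_smooth_step:
  assumes "continuous_map X euclideanreal f"
  shows "continuous_map X euclideanreal (\<lambda>x. smooth_step r (f x))"
proof -
  have "continuous_on UNIV (smooth_step r)"
    unfolding smooth_step_def[abs_def]
    \<comment> \<open>If the constant denominator is \<open>0\<close>, the quotient is
      \<open>0\<close> by convention and the function is constant.\<close>
    by (cases "exp_flat 1 r = 0") (auto intro!: continuous_intros continuous_on_exp_flat
        continuous_on_compose2[OF continuous_on_exp_flat[of UNIV]])
  then show ?thesis
    using continuous_map_compose[OF assms, of euclideanreal "smooth_step r"] by (simp add: o_def)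
qed

lemma Cinf_on_smooth_step:
  assumes V: "openin (Euclidean_space n) V" and "Cinf_on n V f"
  shows "Cinf_on n V (\<lambda>x. smooth_step r (f x))"
proof -
  \<comment> \<open>Differences and the constant quotient are rewritten as sums and products with
    constants, to fit the closure rules.\<close>
  have "Cinf_on n V (\<lambda>x. 1 + (- exp 1) * exp_flat 1 (1 + (- 1 / exp_flat 1 r) * exp_flat 1 (f x)))"
    by (intro Cinf_on_add[OF V] Cinf_on_mult[OF V] Cinf_on_const assms(2)
        Cinf_on_compose[OF V smooth_on_reals_exp_flat])
  then show ?thesis
    by (simp add: smooth_step_def)
qed

subsection \<open>Charts and smooth functions on manifolds\<close>

lemma is_chart_topspace_subtopology:
  "is_chart M n c \<Longrightarrow> topspace (subtopology M (fst c)) = fst c"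
  unfolding is_chart_def using openin_subset by fastforce

lemma is_chart_inj_on: "is_chart M n c \<Longrightarrow> inj_on (snd c) (fst c)"
  by (metis homeomorphic_imp_injective_map is_chart_def is_chart_topspace_subtopology)

lemma chart_inv_apply: "is_chart M n c \<Longrightarrow> z \<in> fst c \<Longrightarrow> chart_inv c (snd c z) = z"
  by (simp add: chart_inv_def is_chart_inj_on)

text \<open>\<open>inv_into\<close> depends on the domain, so shrinking a chart changes
  \<open>chart_inv\<close> as a function; on the image of the smaller domain the two inverses
  agree.\<close>

lemma chart_inv_restrict_apply:
  "is_chart M n c \<Longrightarrow> z \<in> fst c \<Longrightarrow> z \<in> W \<Longrightarrow> chart_inv (fst c \<inter> W, snd c) (snd c z) = z"
  using inj_on_subset[OF is_chart_inj_on, of M n c "fst c \<inter> W"] by (simp add: chart_inv_def)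

lemma is_chart_openin_image:
  assumes c: "is_chart M n c" and W: "openin M W"
  shows "openin (Euclidean_space n) (snd c ` (fst c \<inter> W))"
proof -
  have "open_map (subtopology M (fst c)) (subtopology (Euclidean_space n) (chart_image c)) (snd c)"
    using c homeomorphic_imp_open_map by (auto simp: is_chart_def)
  moreover have "openin (subtopology M (fst c)) (fst c \<inter> W)"
    using W by (rule openin_subtopology_Int2)
  ultimately have "openin (subtopology (Euclidean_space n) (chart_image c)) (snd c ` (fst c \<inter> W))"
    by (simp add: open_map_def)
  then show ?thesis
    using c openin_trans_full is_chart_def by blast
qed

lemma is_chart_restrict:
  assumes c: "is_chart M n c" and W: "openin M W"
  shows "is_chart M n (fst c \<inter> W, snd c)"
proof -
  have sub: "fst c \<inter> W \<subseteq> topspace M" "snd c ` (fst c \<inter> W) \<subseteq> topspace (Euclidean_space n)"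
    using is_chart_openin_image[OF assms] W openin_subset by blast+
  have "homeomorphic_map (subtopology (subtopology M (fst c)) (fst c \<inter> W))
      (subtopology (subtopology (Euclidean_space n) (chart_image c)) (snd c ` (fst c \<inter> W))) (snd c)"
  proof (rule homeomorphic_map_subtopologies)
    show "homeomorphic_map (subtopology M (fst c))
        (subtopology (Euclidean_space n) (chart_image c)) (snd c)"
      using c by (simp add: is_chart_def)
    show "snd c ` (topspace (subtopology M (fst c)) \<inter> (fst c \<inter> W)) =
        topspace (subtopology (Euclidean_space n) (chart_image c)) \<inter> snd c ` (fst c \<inter> W)"
      using sub is_chart_topspace_subtopology[OF c] by (auto simp: chart_image_def)
  qed
  moreover have "fst c \<inter> (fst c \<inter> W) = fst c \<inter> W"
    "chart_image c \<inter> snd c ` (fst c \<inter> W) = snd c ` (fst c \<inter> W)"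
    by (auto simp: chart_image_def)
  ultimately show ?thesis
    using c W is_chart_openin_image[OF assms]
    by (auto simp: is_chart_def chart_image_def subtopology_subtopology)
qed

lemma smooth_structure_is_chart: "smooth_structure M n \<A> \<Longrightarrow> c \<in> \<A> \<Longrightarrow> is_chart M n c"
  by (simp add: smooth_structure_def smooth_atlas_def)

text \<open>The restricted chart is compatible with every chart of the atlas, so it belongs to the
  atlas by maximality.\<close>

lemma smooth_structure_restrict:
  assumes \<A>: "smooth_structure M n \<A>" and c: "c \<in> \<A>" and W: "openin M W"
  shows "(fst c \<inter> W, snd c) \<in> \<A>"
proof -
  let ?r = "(fst c \<inter> W, snd c)"
  note ch = smooth_structure_is_chart[OF \<A>]
  have "compatible_charts n ?r c'" if c': "c' \<in> \<A>" for c'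
  proof -
    have compat: "smooth_transition n c c'" "smooth_transition n c' c"
      using \<A> c c' by (auto simp: smooth_structure_def smooth_atlas_def compatible_charts_def)
    have op: "openin M (fst c \<inter> W \<inter> fst c')"
      using ch[OF c] ch[OF c'] W by (auto simp: is_chart_def)
    have "smooth_transition n ?r c'"
      unfolding smooth_transition_def
    proof (intro allI impI)
      fix j assume "j < n"
      then have "Cinf_on n (snd c ` (fst c \<inter> fst c')) (\<lambda>y. snd c' (chart_inv c y) j)"
        using compat by (simp add: smooth_transition_def)
      then have "Cinf_on n (snd c ` (fst c \<inter> W \<inter> fst c')) (\<lambda>y. snd c' (chart_inv c y) j)"
        by (rule Cinf_on_subset) auto
      moreover have "openin (Euclidean_space n) (snd c ` (fst c \<inter> W \<inter> fst c'))"
        using is_chart_openin_image[OF ch[OF c] op] by (simp add: Int_assoc)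
      ultimately show "Cinf_on n (snd ?r ` (fst ?r \<inter> fst c')) (\<lambda>y. snd c' (chart_inv ?r y) j)"
        unfolding fst_conv snd_conv
        by (elim Cinf_on_cong[rotated 2])
          (auto simp: chart_inv_apply[OF ch[OF c]] chart_inv_restrict_apply[OF ch[OF c]])
    qed
    \<comment> \<open>Here the inverse is that of \<open>c'\<close>, unchanged, so shrinking the
      domain suffices.\<close>
    moreover have "smooth_transition n c' ?r"
      using compat(2) unfolding smooth_transition_def
      by (auto intro: Cinf_on_subset)
    ultimately show ?thesis
      by (simp add: compatible_charts_def)
  qed
  then show ?thesis
    using \<A> is_chart_restrict[OF ch[OF c] W] unfolding smooth_structure_def by blast
qed

text \<open>Each chart can be cut down to a neighbourhood \<open>W\<close> of a given point without
  leaving the atlas, and smoothness is local in the chart image.\<close>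

lemma smooth_real_function_locallyI:
  assumes \<A>: "smooth_structure M n \<A>"
    and loc: "\<And>x. x \<in> topspace M \<Longrightarrow>
      \<exists>W. openin M W \<and> x \<in> W \<and> smooth_real_function n (restrict_charts \<A> W) f"
  shows "smooth_real_function n \<A> f"
  unfolding smooth_real_function_def
proof
  fix c assume c: "c \<in> \<A>"
  note ch = smooth_structure_is_chart[OF \<A> c]
  show "Cinf_on n (chart_image c) (\<lambda>y. f (chart_inv c y))"
  proof (rule Cinf_on_locallyI)
    fix y assume "y \<in> chart_image c"
    then obtain z where z: "z \<in> fst c" "y = snd c z"
      by (auto simp: chart_image_def)
    then have "z \<in> topspace M"
      using ch openin_subset by (auto simp: is_chart_def)
    then obtain W where W: "openin M W" "z \<in> W" "smooth_real_function n (restrict_charts \<A> W) f"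
      using loc by blast
    let ?r = "(fst c \<inter> W, snd c)"
    have "?r \<in> restrict_charts \<A> W"
      using smooth_structure_restrict[OF \<A> c W(1)] by (simp add: restrict_charts_def)
    then have "Cinf_on n (chart_image ?r) (\<lambda>y. f (chart_inv ?r y))"
      using W(3) by (simp add: smooth_real_function_def)
    then have "Cinf_on n (chart_image ?r) (\<lambda>y. f (chart_inv c y))"
      using is_chart_openin_image[OF ch W(1)]
      by (elim Cinf_on_cong[rotated 2])
        (auto simp: chart_image_def chart_inv_apply[OF ch] chart_inv_restrict_apply[OF ch])
    then show "\<exists>W. openin (Euclidean_space n) W \<and> y \<in> W \<and> Cinf_on n W (\<lambda>y. f (chart_inv c y))"
      using is_chart_openin_image[OF ch W(1)] z W(2)
      by (intro exI[of _ "chart_image ?r"]) (auto simp: chart_image_def)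
  qed
qed

lemma smooth_real_function_cong:
  assumes ch: "\<And>c. c \<in> \<A> \<Longrightarrow> is_chart M n c"
    and "\<And>c z. c \<in> \<A> \<Longrightarrow> z \<in> fst c \<Longrightarrow> f z = g z"
    and "smooth_real_function n \<A> f"
  shows "smooth_real_function n \<A> g"
  unfolding smooth_real_function_def
proof
  fix c assume c: "c \<in> \<A>"
  then have "Cinf_on n (chart_image c) (\<lambda>y. f (chart_inv c y))"
    using assms(3) by (simp add: smooth_real_function_def)
  then show "Cinf_on n (chart_image c) (\<lambda>y. g (chart_inv c y))"
    using ch[OF c] assms(2)[OF c]
    by (elim Cinf_on_cong[rotated 2]) (auto simp: is_chart_def chart_image_def chart_inv_apply[OF ch[OF c]])
qed

lemma smooth_real_function_const: "smooth_real_function n \<A> (\<lambda>_. a)"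
  by (simp add: smooth_real_function_def Cinf_on_const)

section \<open>Closure of smooth functions under algebraic operations and the step function\<close>

context
  fixes M :: "'a topology" and n :: nat and \<A> :: "'a chart set"
  assumes charts: "\<And>c. c \<in> \<A> \<Longrightarrow> is_chart M n c"
begin

text \<open>The context asks for a set of charts, so this rule and its companions serve both the
  atlas of a stratum and its restriction to an open subset.\<close>

lemma smooth_real_function_add:
  "\<lbrakk>smooth_real_function n \<A> f; smooth_real_function n \<A> g\<rbrakk>
    \<Longrightarrow> smooth_real_function n \<A> (\<lambda>x. f x + g x)"
  using charts by (auto simp: smooth_real_function_def is_chart_def intro!: Cinf_on_add)

lemma smooth_real_function_mult:
  "\<lbrakk>smooth_real_function n \<A> f; smooth_real_function n \<A> g\<rbrakk>
    \<Longrightarrow> smooth_real_function n \<A> (\<lambda>x. f x * g x)"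
  using charts by (auto simp: smooth_real_function_def is_chart_def intro!: Cinf_on_mult)

lemma smooth_real_function_sum:
  assumes "\<And>j. j \<in> J \<Longrightarrow> smooth_real_function n \<A> (f j)"
  shows "smooth_real_function n \<A> (\<lambda>x. \<Sum>j\<in>J. f j x)"
  using charts assms by (auto simp: smooth_real_function_def is_chart_def intro!: Cinf_on_sum)

lemma smooth_real_function_smooth_step:
  "smooth_real_function n \<A> f \<Longrightarrow> smooth_real_function n \<A> (\<lambda>x. smooth_step r (f x))"
  using charts by (auto simp: smooth_real_function_def is_chart_def intro!: Cinf_on_smooth_step)

end

subsection \<open>Bump functions on s-manifolds\<close>

text \<open>The topology is induced from an infinite product, so \<open>T\<close> contains the trace
  of a box around \<open>p\<close>. Balls are measured by the squared distance because it is a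
  polynomial, hence smooth, in the coordinates.\<close>

lemma openin_Euclidean_space_contains_ball:
  assumes T: "openin (Euclidean_space N) T" and "p \<in> T"
  obtains \<epsilon> where "\<epsilon> > 0"
    "\<And>y. \<lbrakk>y \<in> topspace (Euclidean_space N); (\<Sum>j<N. (y j - p j)\<^sup>2) < \<epsilon>\<rbrakk> \<Longrightarrow> y \<in> T"
proof -
  obtain T' where T': "openin (powertop_real UNIV) T'" "T = T' \<inter> {x. \<forall>i\<ge>N. x i = 0}"
    using T by (auto simp: Euclidean_space_def openin_subtopology)
  have "p \<in> T'"
    using T'(2) \<open>p \<in> T\<close> by simp
  then obtain B where "p \<in> Pi\<^sub>E UNIV B" "\<forall>i. openin euclideanreal (B i)" "Pi\<^sub>E UNIV B \<subseteq> T'"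
    using product_topology_open_contains_basis[OF T'(1)] by meson
  then have B: "\<And>j. p j \<in> B j" "\<And>j. open (B j)" "\<And>y. (\<And>j. y j \<in> B j) \<Longrightarrow> y \<in> T'"
    by (auto simp: PiE_UNIV_domain)
  have "\<exists>e>0. ball (p j) e \<subseteq> B j" for j
    using B(2)[of j] B(1)[of j] by (rule openE) blast
  then obtain e where e: "\<And>j. e j > 0" "\<And>j. ball (p j) (e j) \<subseteq> B j"
    by metis
  \<comment> \<open>The squares match the squared distance; the extra \<open>1\<close> keeps the set
    nonempty when \<open>N = 0\<close>.\<close>
  define \<epsilon> where "\<epsilon> = Min (insert 1 ((\<lambda>j. (e j)\<^sup>2) ` {..<N}))"
  show thesis
  proof
    show "\<epsilon> > 0"
      using e(1)[THEN less_imp_neq] by (auto simp: \<epsilon>_def)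
    fix y assume y: "y \<in> topspace (Euclidean_space N)" "(\<Sum>j<N. (y j - p j)\<^sup>2) < \<epsilon>"
    have "y j \<in> B j" for j
    proof (cases "j < N")
      case True
      have "(y j - p j)\<^sup>2 \<le> (\<Sum>j<N. (y j - p j)\<^sup>2)"
        using True by (intro member_le_sum) auto
      also have "\<dots> < \<epsilon>" by (rule y(2))
      also have "\<epsilon> \<le> (e j)\<^sup>2"
        unfolding \<epsilon>_def using True by (intro Min_le) auto
      finally have "\<bar>y j - p j\<bar>\<^sup>2 < (e j)\<^sup>2"
        by simp
      then have "\<bar>y j - p j\<bar> < e j"
        by (rule power2_less_imp_less) (simp add: e(1) less_imp_le)
      then have "y j \<in> ball (p j) (e j)"
        by (simp add: dist_real_def abs_minus_commute)
      then show ?thesis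
        using e(2)[of j] by blast
    next
      \<comment> \<open>Beyond index \<open>N\<close> both points have coordinate
        \<open>0\<close>.\<close>
      case False
      then have "y j = p j"
        using y(1) T'(2) \<open>p \<in> T\<close> by (simp add: topspace_Euclidean_space)
      then show ?thesis
        using B(1) by simp
    qed
    then have "y \<in> T'"
      by (rule B(3))
    then show "y \<in> T"
      using y(1) T'(2) by (simp add: topspace_Euclidean_space)
  qed
qed

lemma continuous_map_Euclidean_space_component:
  "continuous_map X (Euclidean_space N) f \<Longrightarrow> continuous_map X euclideanreal (\<lambda>x. f x j)"
  by (simp add: Euclidean_space_def continuous_map_in_subtopology continuous_map_componentwise_UNIV)

section \<open>Algebra of smooth functions on an s-manifold, and existence of bumps\<close>

context s_manifold
begin

lemma stratum_smooth_structure: "i \<in> I \<Longrightarrow> smooth_structure (subtopology X (S i)) (d i) (\<A> i)"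
  using strata_manifold by (simp add: smooth_manifold_def)

lemma stratum_chart: "i \<in> I \<Longrightarrow> c \<in> \<A> i \<Longrightarrow> is_chart (subtopology X (S i)) (d i) c"
  using stratum_smooth_structure smooth_structure_is_chart by blast

abbreviation s_smooth :: "('a \<Rightarrow> real) \<Rightarrow> bool" where
  "s_smooth \<equiv> s_smooth_function X I d \<A>"

lemma s_smooth_const: "s_smooth (\<lambda>_. c)"
  by (simp add: s_smooth_function_def smooth_real_function_const)

lemma s_smooth_add: "s_smooth f \<Longrightarrow> s_smooth g \<Longrightarrow> s_smooth (\<lambda>x. f x + g x)"
  unfolding s_smooth_function_def
  using smooth_real_function_add[OF stratum_chart] by (simp add: continuous_map_add)

lemma s_smooth_mult: "s_smooth f \<Longrightarrow> s_smooth g \<Longrightarrow> s_smooth (\<lambda>x. f x * g x)"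
  unfolding s_smooth_function_def
  using smooth_real_function_mult[OF stratum_chart] by (simp add: continuous_map_real_mult)

lemma s_smooth_compl: "s_smooth f \<Longrightarrow> s_smooth (\<lambda>x. 1 - f x)"
  using s_smooth_add[OF s_smooth_const[of 1] s_smooth_mult[OF s_smooth_const[of "- 1"], of f]] by simp

lemma s_smooth_sum:
  "(\<And>k. k \<in> K \<Longrightarrow> s_smooth (f k)) \<Longrightarrow> s_smooth (\<lambda>x. \<Sum>k\<in>K. f k x)"
proof (induction K rule: infinite_finite_induct)
  case (insert k K)
  then show ?case using s_smooth_add[of "f k" "\<lambda>x. \<Sum>k\<in>K. f k x"] by simp
qed (simp_all add: s_smooth_const)

lemma s_smooth_prod:
  "(\<And>k. k \<in> K \<Longrightarrow> s_smooth (f k)) \<Longrightarrow> s_smooth (\<lambda>x. \<Prod>k\<in>K. f k x)"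
proof (induction K rule: infinite_finite_induct)
  case (insert k K)
  then show ?case using s_smooth_mult[of "f k" "\<lambda>x. \<Prod>k\<in>K. f k x"] by simp
qed (simp_all add: s_smooth_const)

lemma smooth_real_function_restrict_charts:
  "smooth_real_function m \<B> f \<Longrightarrow> smooth_real_function m (restrict_charts \<B> W) f"
  by (simp add: smooth_real_function_def restrict_charts_def)

lemma restrict_charts_is_chart:
  "i \<in> I \<Longrightarrow> c \<in> restrict_charts (\<A> i) W \<Longrightarrow> is_chart (subtopology X (S i)) (d i) c"
  using stratum_chart by (simp add: restrict_charts_def)

text \<open>The local models \<open>g\<close> are smooth on the whole space; this form fits a
  locally finite sum, which equals a finite sum near each point.\<close>

lemma s_smooth_locallyI:
  assumes "\<And>x. x \<in> topspace X \<Longrightarrow>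
    \<exists>W g. openin X W \<and> x \<in> W \<and> s_smooth g \<and> (\<forall>z\<in>W. f z = g z)"
  shows "s_smooth f"
  unfolding s_smooth_function_def
proof (intro conjI ballI)
  show "continuous_map X euclideanreal f"
  proof (rule continuous_map_locallyI)
    fix x assume "x \<in> topspace X"
    then obtain W g where W: "openin X W" "x \<in> W" "s_smooth g" "\<And>z. z \<in> W \<Longrightarrow> f z = g z"
      using assms by meson
    then have "continuous_map (subtopology X W) euclideanreal g"
      by (simp add: s_smooth_function_def continuous_map_from_subtopology)
    then have "continuous_map (subtopology X W) euclideanreal f"
      by (rule continuous_map_eq) (simp add: W(4))
    then show "\<exists>W. openin X W \<and> x \<in> W \<and> continuous_map (subtopology X W) euclideanreal f"
      using W by blast
  qed
  fix i assume i: "i \<in> I"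
  show "smooth_real_function (d i) (\<A> i) f"
  proof (rule smooth_real_function_locallyI[OF stratum_smooth_structure[OF i]])
    fix x assume x: "x \<in> topspace (subtopology X (S i))"
    then have "x \<in> topspace X"
      by simp
    then obtain W g where W: "openin X W" "x \<in> W" "s_smooth g" "\<And>z. z \<in> W \<Longrightarrow> f z = g z"
      using assms by meson
    have "smooth_real_function (d i) (restrict_charts (\<A> i) (S i \<inter> W)) g"
      using W(3) i by (simp add: s_smooth_function_def smooth_real_function_restrict_charts)
    then have "smooth_real_function (d i) (restrict_charts (\<A> i) (S i \<inter> W)) f"
      by (rule smooth_real_function_cong[rotated 2])
        (use restrict_charts_is_chart[OF i] W(4) in \<open>auto simp: restrict_charts_def\<close>)
    then show "\<exists>W. openin (subtopology X (S i)) W \<and> x \<in> W \<and>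
        smooth_real_function (d i) (restrict_charts (\<A> i) W) f"
      using W(1,2) x openin_subtopology_Int2[OF W(1), of "S i"] by auto
  qed
qed

text \<open>A step function of the squared distance in a local embedding is extended by
  \<open>0\<close>. A compact neighbourhood \<open>K\<close> inside \<open>U \<inter> G\<close> is
  closed in \<open>X\<close>, so \<open>U\<close> and the complement of \<open>K\<close> form an
  open cover on whose members smoothness is evident.\<close>

lemma ex_bump_function:
  assumes G: "openin X G" and x: "x \<in> G"
  shows "\<exists>b W. s_smooth b \<and> (\<forall>z. b z \<in> {0..1}) \<and> openin X W \<and> x \<in> W \<and>
    (\<forall>z\<in>W. b z = 1) \<and> supp_in X b \<subseteq> G"
proof -
  have "x \<in> topspace X"
    using G x openin_subset by blast
  from local_embedding[OF this] obtain U N f where U: "openin X U" "x \<in> U"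
    and emb: "embedding_map (subtopology X U) (Euclidean_space N) f"
    and smf: "\<forall>i\<in>I. smooth_embedding (subtopology X (U \<inter> S i)) (d i)
                  (restrict_charts (\<A> i) (U \<inter> S i)) N f"
    by (elim exE conjE)
  have "neighbourhood_base_of (compactin X) X"
    using locally_compact Hausdorff locally_compact_space_neighbourhood_base by blast
  then obtain Q K where Q: "openin X Q" "compactin X K" "x \<in> Q" "Q \<subseteq> K" "K \<subseteq> U \<inter> G"
    using U G x unfolding neighbourhood_base_of by (metis IntI openin_Int)
  have K: "closedin X K"
    using Q(2) Hausdorff compactin_imp_closedin by blast
  have topU: "topspace (subtopology X U) = U"
    using U openin_subset by fastforce
  have hom: "homeomorphic_map (subtopology X U) (subtopology (Euclidean_space N) (f ` U)) f"
    using emb unfolding embedding_map_def topU .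
  have contf: "continuous_map (subtopology X U) (Euclidean_space N) f"
    using homeomorphic_imp_continuous_map[OF hom] continuous_map_in_subtopology by blast
  have inj: "inj_on f U"
    using homeomorphic_imp_injective_map[OF hom] topU by simp
  have "openin (subtopology X U) Q"
    using Q U by (auto simp: openin_open_subtopology)
  then have "openin (subtopology (Euclidean_space N) (f ` U)) (f ` Q)"
    using homeomorphic_imp_open_map[OF hom] by (simp add: open_map_def)
  \<comment> \<open>As \<open>f\<close> is an embedding, being close to \<open>f x\<close> in
    \<open>\<real>\<^sup>N\<close> forces a point of \<open>U\<close> to lie in
    \<open>Q\<close>.\<close>
  then obtain T where T: "openin (Euclidean_space N) T" "f ` Q = T \<inter> f ` U"
    by (auto simp: openin_subtopology)
  then have "f x \<in> T"
    using Q(3) by blast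
  then obtain \<epsilon> where \<epsilon>: "\<epsilon> > 0"
    "\<And>y. \<lbrakk>y \<in> topspace (Euclidean_space N); (\<Sum>j<N. (y j - f x j)\<^sup>2) < \<epsilon>\<rbrakk> \<Longrightarrow> y \<in> T"
    using openin_Euclidean_space_contains_ball[OF T(1)] by metis
  define s where "s z = (\<Sum>j<N. (f z j + (- f x j)) * (f z j + (- f x j)))" for z
  have s_Q: "z \<in> Q" if "z \<in> U" "s z < \<epsilon>" for z
  proof -
    have "f z \<in> topspace (Euclidean_space N)"
      using contf that topU by (auto simp: continuous_map_def)
    then have "f z \<in> f ` Q"
      using \<epsilon>(2)[of "f z"] T(2) that by (simp add: s_def power2_eq_square)
    then show ?thesis
      using inj that Q by (auto dest: inj_onD)
  qed
  have conts: "continuous_map (subtopology X U) euclideanreal s"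
    unfolding s_def[abs_def]
    by (intro continuous_map_sum continuous_map_real_mult continuous_map_add
        continuous_map_Euclidean_space_component[OF contf]) auto
  \<comment> \<open>This is \<open>0\<close> where \<open>s z \<ge> \<epsilon>\<close> and
    \<open>1\<close> where \<open>s z \<le> \<epsilon> / 2\<close>.\<close>
  define h where "h z = smooth_step (\<epsilon> / 2) (\<epsilon> + (- 1) * s z)" for z
  define b where "b z = (if z \<in> U then h z else 0)" for z
  \<comment> \<open>Outside \<open>U\<close> this is the default value; inside \<open>U\<close>, a
    point outside \<open>K\<close> is outside \<open>Q\<close>, so its squared distance is at least
    \<open>\<epsilon>\<close>.\<close>
  have b_out: "b z = 0" if "z \<notin> K" for z
    using s_Q[of z] Q(4) that smooth_step_eq_0[of "\<epsilon> - s z" "\<epsilon> / 2"] by (force simp: b_def h_def)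
  have supp: "supp_in X b \<subseteq> K"
    unfolding supp_in_def by (rule closure_of_minimal) (use K b_out in auto)
  define W where "W = {z \<in> U. s z < \<epsilon> / 2}"
  have "openin (subtopology X U) {z \<in> topspace (subtopology X U). s z \<in> {..< \<epsilon> / 2}}"
    by (rule openin_continuous_map_preimage[OF conts]) simp
  then have "openin (subtopology X U) W"
    unfolding topU by (simp add: W_def)
  then have W: "openin X W"
    using U(1) by (rule openin_trans_full)
  have contb: "continuous_map X euclideanreal b"
  proof (rule continuous_map_locallyI)
    fix z assume z: "z \<in> topspace X"
    have "continuous_map (subtopology X U) euclideanreal h"
      unfolding h_def[abs_def]
      by (intro continuous_map_smooth_step continuous_map_add continuous_map_real_mult_left conts) simp
    then have "continuous_map (subtopology X U) euclideanreal b"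
      by (rule continuous_map_eq) (auto simp: b_def)
    moreover have "continuous_map (subtopology X (topspace X - K)) euclideanreal b"
      by (rule continuous_map_eq[of _ _ "\<lambda>_. 0"]) (auto simp: b_out)
    moreover have "z \<in> U \<or> z \<in> topspace X - K"
      using Q(5) z by blast
    ultimately show "\<exists>W. openin X W \<and> z \<in> W \<and> continuous_map (subtopology X W) euclideanreal b"
      using U(1) K by blast
  qed
  have smb: "smooth_real_function (d i) (\<A> i) b" if i: "i \<in> I" for i
  proof (rule smooth_real_function_locallyI[OF stratum_smooth_structure[OF i]])
    fix z assume z: "z \<in> topspace (subtopology X (S i))"
    note ch = restrict_charts_is_chart[OF i]
    \<comment> \<open>\<open>h\<close> is built by the closure rules from the coordinates of
      \<open>f\<close>, which are smooth on every stratum.\<close>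
    have "smooth_real_function (d i) (restrict_charts (\<A> i) (U \<inter> S i)) h"
      unfolding h_def[abs_def] s_def[abs_def]
      by (intro smooth_real_function_smooth_step[OF ch] smooth_real_function_add[OF ch]
          smooth_real_function_mult[OF ch] smooth_real_function_sum[OF ch] smooth_real_function_const)
        (use bspec[OF smf i] in \<open>auto simp: smooth_embedding_def\<close>)
    then have "smooth_real_function (d i) (restrict_charts (\<A> i) (U \<inter> S i)) b"
      by (rule smooth_real_function_cong[rotated 2]) (use ch in \<open>auto simp: b_def restrict_charts_def\<close>)
    moreover have "smooth_real_function (d i) (restrict_charts (\<A> i) ((topspace X - K) \<inter> S i)) b"
      by (rule smooth_real_function_cong[OF _ _ smooth_real_function_const[of _ _ 0]])
        (use ch in \<open>auto simp: b_out restrict_charts_def\<close>)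
    moreover have "z \<in> U \<inter> S i \<or> z \<in> (topspace X - K) \<inter> S i"
      using Q(5) z by auto
    moreover have "openin (subtopology X (S i)) (U \<inter> S i)"
      "openin (subtopology X (S i)) ((topspace X - K) \<inter> S i)"
      using U(1) K by (auto intro: openin_subtopology_Int)
    ultimately show "\<exists>W. openin (subtopology X (S i)) W \<and> z \<in> W \<and>
        smooth_real_function (d i) (restrict_charts (\<A> i) W) b"
      by blast
  qed
  have "s_smooth b"
    using contb smb by (simp add: s_smooth_function_def)
  moreover have "b z \<in> {0..1}" for z
    using smooth_step_bounds by (simp add: b_def h_def)
  moreover have "x \<in> W"
    using U \<epsilon> by (simp add: W_def s_def)
  moreover have "b z = 1" if "z \<in> W" for z
    using that \<epsilon> by (simp add: W_def b_def h_def smooth_step_eq_1)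
  ultimately show ?thesis
    using W supp Q(5) by blast
qed

end

section \<open>Assembling the partition of unity from countably many bumps\<close>

lemma prod_compl_telescope:
  fixes b :: "nat \<Rightarrow> 'a :: comm_ring_1"
  shows "(\<Sum>k<m. b k * (\<Prod>j<k. 1 - b j)) = 1 - (\<Prod>j<m. 1 - b j)"
  \<comment> \<open>Each summand is the product over \<open>j < k\<close> minus the product over
    \<open>j \<le> k\<close>.\<close>
  by (induction m) (simp_all add: algebra_simps)

theorem theorem3p16:
  fixes n :: nat
    and X :: "'a topology"
    and I :: "'i set"
    and S :: "'i \<Rightarrow> 'a set"
    and d :: "'i \<Rightarrow> nat"
    and \<A> :: "'i \<Rightarrow> 'a chart set"
    and A :: "'b set"
    and U :: "'b \<Rightarrow> 'a set"
  assumes "s_manifold n X I S d \<A>"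
    and "\<And>a. a \<in> A \<Longrightarrow> openin X (U a)"
    and "(\<Union>a\<in>A. U a) = topspace X"
  shows "\<exists>\<eta> :: 'b \<Rightarrow> 'a \<Rightarrow> real.
    (\<forall>a\<in>A. s_smooth_function X I d \<A> (\<eta> a)) \<and>
    (\<forall>a\<in>A. \<eta> a ` topspace X \<subseteq> {0..1}) \<and>
    (\<forall>a\<in>A. supp_in X (\<eta> a) \<subseteq> U a) \<and>
    (\<forall>x\<in>topspace X. \<exists>V. openin X V \<and> x \<in> V \<and>
       finite {a\<in>A. supp_in X (\<eta> a) \<inter> V \<noteq> {}}) \<and>
    (\<forall>x\<in>topspace X. supp_sum (\<lambda>a. \<eta> a x) A = 1)"
proof (cases "topspace X = {}")
  \<comment> \<open>Enumerating a countable subcover by \<open>nat\<close> requires it to be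
    nonempty, so the empty space is treated apart, with zero functions.\<close>
  case True
  interpret s_manifold n X I S d \<A> by fact
  show ?thesis
    using True s_smooth_const[of 0] by (intro exI[of _ "\<lambda>_ _. 0"]) (auto simp: supp_in_def)
next
  case False
  interpret s_manifold n X I S d \<A> by fact
  define good where "good W a b \<longleftrightarrow> a \<in> A \<and> s_smooth b \<and> (\<forall>z. b z \<in> {0..1}) \<and> openin X W \<and>
    (\<forall>z\<in>W. b z = 1) \<and> supp_in X b \<subseteq> U a" for W a b
  define \<W> where "\<W> = {W. openin X W \<and> (\<exists>a b. good W a b)}"
  have "\<exists>W\<in>\<W>. x \<in> W" if "x \<in> topspace X" for x
  proof -
    have "x \<in> (\<Union>a\<in>A. U a)"
      using that by (simp only: assms(3))
    then obtain a where a: "a \<in> A" "x \<in> U a"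
      by (elim UN_E)
    from ex_bump_function[OF assms(2)[OF a(1)] a(2)]
    obtain b W where W: "s_smooth b" "\<forall>z. b z \<in> {0..1}" "openin X W" "x \<in> W"
      "\<forall>z\<in>W. b z = 1" "supp_in X b \<subseteq> U a"
      by (elim exE conjE)
    then have "good W a b"
      using a(1) by (simp add: good_def)
    with W(3,4) show ?thesis
      unfolding \<W>_def by (intro bexI[of _ W] CollectI conjI exI)
  qed
  moreover have open_\<W>: "\<forall>W\<in>\<W>. openin X W"
    by (simp add: \<W>_def)
  ultimately have "\<Union>\<W> = topspace X"
    by (intro subset_antisym Union_least subsetI) (auto dest: openin_subset)
  with open_\<W> obtain \<V> where \<V>: "countable \<V>" "\<V> \<subseteq> \<W>" "\<Union>\<V> = topspace X"
    using second_countable_imp_Lindelof_space[OF second_countable]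
    unfolding Lindelof_space_def by meson
  \<comment> \<open>A finite subcover is enumerated with repetitions, which do no harm.\<close>
  define W where "W = from_nat_into \<V>"
  have "\<V> \<noteq> {}"
    using \<V>(3) False by blast
  then have W\<V>: "range W = \<V>"
    using \<V>(1) by (simp add: W_def range_from_nat_into)
  then have "W k \<in> \<W>" for k
    using \<V>(2) by blast
  then have "\<exists>a b. good (W k) a b" for k
    by (simp add: \<W>_def)
  then obtain \<alpha> b where good: "\<And>k. good (W k) (\<alpha> k) (b k)"
    by metis
  have W_cover: "\<exists>m. x \<in> W m" if "x \<in> topspace X" for x
    using \<V>(3) W\<V> that by blast
  define h where "h k x = b k x * (\<Prod>j<k. 1 - b j x)" for k x
  have h0: "h k x \<ge> 0" for k x
    using good by (auto simp: h_def good_def intro!: mult_nonneg_nonneg prod_nonneg)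
  have h_smooth: "s_smooth (h k)" for k
    using good unfolding h_def[abs_def] good_def
    by (intro s_smooth_mult s_smooth_prod s_smooth_compl) auto
  \<comment> \<open>The product in \<open>h k\<close> contains the factor \<open>1 - b m x\<close>,
    which is \<open>0\<close>.\<close>
  have h_vanish: "h k x = 0" if "x \<in> W m" "m < k" for k m x
    using good[of m] that by (auto simp: h_def good_def)
  \<comment> \<open>Summing over nonzero terms avoids a choice of \<open>m\<close>; at a point of
    \<open>W m\<close> the index set is finite, being contained in \<open>{..m}\<close>.\<close>
  define \<eta> where "\<eta> a x = (\<Sum>k | \<alpha> k = a \<and> h k x \<noteq> 0. h k x)" for a x
  have \<eta>_eq: "\<eta> a x = (\<Sum>k | k \<le> m \<and> \<alpha> k = a. h k x)" if "x \<in> W m" for a x m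
    unfolding \<eta>_def
    by (rule sum.mono_neutral_left) (use h_vanish[OF that] not_le in auto)
  \<comment> \<open>The index \<open>m\<close> must be included: the telescoped product then runs
    over \<open>j < Suc m\<close> and contains the zero factor \<open>1 - b m x\<close>.\<close>
  have h_sum: "(\<Sum>k\<le>m. h k x) = 1" if "x \<in> W m" for x m
    using prod_compl_telescope[of "\<lambda>k. b k x" "Suc m"] good[of m] that
    by (auto simp: h_def good_def lessThan_Suc_atMost[symmetric])
  have \<eta>_ne: "\<exists>k\<le>m. \<alpha> k = a \<and> b k x \<noteq> 0" if "x \<in> W m" "\<eta> a x \<noteq> 0" for a x m
  proof -
    have "(\<Sum>k | k \<le> m \<and> \<alpha> k = a. h k x) \<noteq> 0"
      using that(2) by (simp add: \<eta>_eq[OF that(1)])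
    then obtain k where "k \<in> {k. k \<le> m \<and> \<alpha> k = a}" "h k x \<noteq> 0"
      by (rule sum.not_neutral_contains_not_neutral)
    then show ?thesis
      by (intro exI[of _ k]) (simp add: h_def)
  qed
  have openW: "openin X (W m)" for m
    using good by (simp add: good_def)
  \<comment> \<open>On the open set \<open>W m\<close> the support is controlled by finitely many
    bumps, and closure commutes with finite unions. Both the support condition and local finiteness
    follow from this.\<close>
  have supp_W: "supp_in X (\<eta> a) \<inter> W m \<subseteq> (\<Union>k\<in>{k. k \<le> m \<and> \<alpha> k = a}. supp_in X (b k))" for a m
  proof -
    have "W m \<inter> supp_in X (\<eta> a) \<subseteq> X closure_of (W m \<inter> {x \<in> topspace X. \<eta> a x \<noteq> 0})"
      unfolding supp_in_def by (rule openin_Int_closure_of_subset[OF openW])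
    also have "\<dots> \<subseteq> X closure_of (\<Union>k\<in>{k. k \<le> m \<and> \<alpha> k = a}. {x \<in> topspace X. b k x \<noteq> 0})"
      by (rule closure_of_mono) (use \<eta>_ne in blast)
    also have "\<dots> = (\<Union>k\<in>{k. k \<le> m \<and> \<alpha> k = a}. supp_in X (b k))"
      by (subst closure_of_Union) (auto simp: supp_in_def)
    finally show ?thesis by blast
  qed
  have \<eta>0: "\<eta> a x \<ge> 0" for a x
    by (simp add: \<eta>_def h0 sum_nonneg)
  show ?thesis
  proof (intro exI[of _ \<eta>] conjI ballI)
    fix a assume "a \<in> A"
    show "s_smooth (\<eta> a)"
    proof (rule s_smooth_locallyI)
      fix x assume "x \<in> topspace X"
      then obtain m where "x \<in> W m" using W_cover by blast
      moreover have "s_smooth (\<lambda>x. \<Sum>k | k \<le> m \<and> \<alpha> k = a. h k x)"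
        by (intro s_smooth_sum h_smooth)
      ultimately show "\<exists>W g. openin X W \<and> x \<in> W \<and> s_smooth g \<and> (\<forall>z\<in>W. \<eta> a z = g z)"
        using openW[of m] \<eta>_eq
        by (intro exI[of _ "W m"] exI[of _ "\<lambda>x. \<Sum>k | k \<le> m \<and> \<alpha> k = a. h k x"]) simp
    qed
  next
    fix a assume "a \<in> A"
    show "\<eta> a ` topspace X \<subseteq> {0..1}"
    proof
      fix y assume "y \<in> \<eta> a ` topspace X"
      then obtain x where x: "x \<in> topspace X" "y = \<eta> a x" by blast
      then obtain m where m: "x \<in> W m" using W_cover by blast
      have "\<eta> a x \<le> (\<Sum>k\<le>m. h k x)"
        unfolding \<eta>_eq[OF m] by (rule sum_mono2) (auto simp: h0)
      then show "y \<in> {0..1}"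
        using \<eta>0 x by (simp add: h_sum[OF m])
    qed
  next
    fix a assume "a \<in> A"
    show "supp_in X (\<eta> a) \<subseteq> U a"
    proof
      fix x assume x: "x \<in> supp_in X (\<eta> a)"
      then have "x \<in> topspace X"
        using closure_of_subset_topspace unfolding supp_in_def by fastforce
      then obtain m where "x \<in> W m" using W_cover by blast
      then obtain k where "\<alpha> k = a" "x \<in> supp_in X (b k)"
        using supp_W[of a m] x by blast
      then show "x \<in> U a"
        using good[of k] by (auto simp: good_def)
    qed
  next
    fix x assume "x \<in> topspace X"
    then obtain m where m: "x \<in> W m" using W_cover by blast
    \<comment> \<open>A support that meets \<open>W m\<close> contributes at least one bump with
      index \<open>k \<le> m\<close>, and \<open>a\<close> is the label of that bump.\<close>
    have "{a \<in> A. supp_in X (\<eta> a) \<inter> W m \<noteq> {}} \<subseteq> \<alpha> ` {..m}"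
      using supp_W by blast
    then have "finite {a \<in> A. supp_in X (\<eta> a) \<inter> W m \<noteq> {}}"
      by (rule finite_subset) simp
    then show "\<exists>V. openin X V \<and> x \<in> V \<and> finite {a \<in> A. supp_in X (\<eta> a) \<inter> V \<noteq> {}}"
      using m openW by blast
  next
    fix x assume "x \<in> topspace X"
    then obtain m where m: "x \<in> W m" using W_cover by blast
    \<comment> \<open>The labels up to \<open>m\<close> lie in \<open>A\<close> and include every
      \<open>a\<close> with \<open>\<eta> a x \<noteq> 0\<close>, so the sum over the support may be
      taken over them; regrouping along the fibres of \<open>\<alpha>\<close> then gives the
      telescoping sum.\<close>
    have "supp_sum (\<lambda>a. \<eta> a x) A = (\<Sum>a\<in>\<alpha> ` {..m}. \<eta> a x)"
      unfolding supp_sum_def support_on_def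
    proof (rule sum.mono_neutral_left)
      show "{a \<in> A. \<eta> a x \<noteq> 0} \<subseteq> \<alpha> ` {..m}"
        using \<eta>_ne[OF m] by blast
      show "\<forall>a\<in>\<alpha> ` {..m} - {a \<in> A. \<eta> a x \<noteq> 0}. \<eta> a x = 0"
        using good by (auto simp: good_def)
    qed simp
    also have "\<dots> = (\<Sum>a\<in>\<alpha> ` {..m}. \<Sum>k | k \<in> {..m} \<and> \<alpha> k = a. h k x)"
      by (simp add: \<eta>_eq[OF m])
    also have "\<dots> = (\<Sum>k\<le>m. h k x)"
      by (rule sum.image_gen[symmetric]) simp
    finally show "supp_sum (\<lambda>a. \<eta> a x) A = 1"
      by (simp add: h_sum[OF m])
  qed
qed

end
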